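(* Let $\Phi_i$ ($1\le i\le 30$) be any primary 3-form of the Clifford algebra $\mathcal G_7$, let $I=e_{1234567}$ and $\Phi_i^*=-I\,\Phi_i$. Then: (a) the terms of $1+\Phi_i^*$ (the scalar $1$ and the seven basis 4-forms occurring in $\Phi_i^*$) are elements of $\mathrm{Spin}(7)$, they commute pairwise, and their real linear span is closed under multiplication, i.e. is a commutative subalgebra of $\mathcal G_7$; (b) the terms of $1+\Phi_i+\Phi_i^*+I$ (the scalar $1$, the seven basis 3-forms of $\Phi_i$, the seven basis 4-forms of $\Phi_i^*$, and $I$) are elements of $\mathrm{Pin}(7)$, they commute pairwise, and their real linear span is closed under multiplication, i.e. is a commutative subalgebra of $\mathcal G_7$.
   Context: $\mathcal G_7=\mathrm{Cl}(7,0)$ is the real Clifford algebra generated by $e_1,\dots,e_7$ with $e_a^2=1$ and $e_ae_b=-e_be_a$ for $a\ne b$. Write $e_{a_1a_2\cdots a_r}=e_{a_1}e_{a_2}\cdots e_{a_r}$; for distinct indices this is called a basis $r$-form. $\mathrm{Pin}(7)$ is the group of all products of unit vectors in $\mathcal G_7$, and $\mathrm{Spin}(7)$ is the subgroup of products of an even number of unit vectors. A primary 3-form is a sum $\Phi=\sum_{\{a<b<c\}\in F} e_{abc}$ (all coefficients $+1$), where $F$ is a set of seven 3-element subsets of $\{1,\dots,7\}$ such that every 2-element subset of $\{1,\dots,7\}$ is contained in exactly one member of $F$ (so $F$ is the set of lines of a Fano plane on $\{1,\dots,7\}$). There are 30 such $F$, giving the primary 3-forms $\Phi_1,\dots,\Phi_{30}$;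 for example $\Phi_1=e_{123}+e_{145}+e_{167}+e_{246}+e_{257}+e_{347}+e_{356}$. The dual of $X\in\mathcal G_7$ is $X^*=-e_{1234567}X$. The dual $\Phi_i^*$ of a primary 3-form is a sum of seven basis 4-forms with coefficients $\pm1$. *)

theory Defs
  imports Complex_Main
begin

text \<open>
  The Clifford algebra Cl(7,0) is constructed on the 128-dimensional real space of
  coefficient families \<open>f\<close> indexed by the subsets of \<open>{1..7}\<close>; \<open>f A\<close> is the coefficient of
  \<open>e_A = e_a e_b \<dots> e_z\<close>, where \<open>A = {a < b < \<dots> < z}\<close>.
\<close>

typedef clifford7 = "{f :: nat set \<Rightarrow> real. \<forall>A. \<not> A \<subseteq> {1..7} \<longrightarrow> f A = 0}"
  morphisms coeff Abs_clifford7
  by (rule exI[of _ "\<lambda>_. 0"]) simp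

setup_lifting type_definition_clifford7

lemma clifford7_eqI:
  assumes "\<And>A. A \<subseteq> {1..7} \<Longrightarrow> coeff x A = coeff y A"
  shows "x = y"
proof -
  have "coeff x A = coeff y A" for A
    using assms coeff[of x] coeff[of y] by (cases "A \<subseteq> {1..7}") simp_all
  then show ?thesis by (simp add: coeff_inject[symmetric] fun_eq_iff)
qed

lemma coeff_outside: "\<not> A \<subseteq> {1..7} \<Longrightarrow> coeff x A = 0"
  using coeff[of x] by simp

text \<open>
  Since \<open>e_a\<^sup>2 = 1\<close> and distinct generators anticommute, \<open>e_A e_B = \<plusminus> e_C\<close> with \<open>C\<close> the symmetric
  difference of \<open>A\<close> and \<open>B\<close>. Sorting the factors needs one transposition of distinct generators
  for each pair \<open>(a, b)\<close> in \<open>A \<times> B\<close> with \<open>b < a\<close>, hence the following sign.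
\<close>

definition reorder_sign :: "nat set \<Rightarrow> nat set \<Rightarrow> real" where
  "reorder_sign A B = (\<Prod>a\<in>A. \<Prod>b\<in>B. if b < a then -1 else 1)"

lemma prod_sym_diff:
  fixes g :: "nat \<Rightarrow> real"
  assumes "finite A" "finite B" "\<And>a. g a * g a = 1"
  shows "prod g (sym_diff A B) = prod g A * prod g B"
proof -
  have A: "prod g A = prod g (A \<inter> B) * prod g (A - B)"
    using assms(1) by (rule prod.Int_Diff)
  have B: "prod g B = prod g (A \<inter> B) * prod g (B - A)"
    using prod.Int_Diff[OF assms(2), of g A] by (simp only: Int_commute)
  have "prod g (A \<inter> B) * prod g (A \<inter> B) = 1"
    by (simp only: prod.distrib[symmetric] assms(3) prod.neutral_const)
  then have "prod g A * prod g B = prod g (A - B) * prod g (B - A)"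
    unfolding A B by (metis mult.assoc mult.commute mult_1)
  moreover have "prod g (sym_diff A B) = prod g (A - B) * prod g (B - A)"
    using assms by (intro prod.union_disjoint) auto
  ultimately show ?thesis by simp
qed

lemma reorder_sign_square: "reorder_sign A B * reorder_sign A B = 1"
  unfolding reorder_sign_def prod.distrib[symmetric] by (intro prod.neutral ballI) auto

lemma reorder_sign_sym_diff_left:
  "finite A \<Longrightarrow> finite B \<Longrightarrow>
    reorder_sign (sym_diff A B) C = reorder_sign A C * reorder_sign B C"
  unfolding reorder_sign_def
  by (rule prod_sym_diff) (auto simp: prod.distrib[symmetric] intro!: prod.neutral)

lemma reorder_sign_sym_diff_right:
  assumes "finite B" "finite C"
  shows "reorder_sign A (sym_diff B C) = reorder_sign A B * reorder_sign A C"
  unfolding reorder_sign_def prod.distrib[symmetric]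
  using assms by (intro prod.cong prod_sym_diff) auto

lemma reorder_sign_empty [simp]: "reorder_sign {} A = 1" "reorder_sign A {} = 1"
  by (auto simp: reorder_sign_def)

instantiation clifford7 :: real_algebra_1
begin

lift_definition zero_clifford7 :: clifford7 is "\<lambda>_. 0" by simp

lift_definition one_clifford7 :: clifford7 is "\<lambda>A. if A = {} then 1 else 0" by auto

lift_definition plus_clifford7 :: "clifford7 \<Rightarrow> clifford7 \<Rightarrow> clifford7"
  is "\<lambda>f g A. f A + g A" by simp

lift_definition minus_clifford7 :: "clifford7 \<Rightarrow> clifford7 \<Rightarrow> clifford7"
  is "\<lambda>f g A. f A - g A" by simp

lift_definition uminus_clifford7 :: "clifford7 \<Rightarrow> clifford7"
  is "\<lambda>f A. - f A" by simp

lift_definition scaleR_clifford7 :: "real \<Rightarrow> clifford7 \<Rightarrow> clifford7"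
  is "\<lambda>r f A. r * f A" by simp

text \<open>For each \<open>A\<close>, the unique \<open>B\<close> with \<open>sym_diff A B = C\<close> is \<open>sym_diff A C\<close>.\<close>

lift_definition times_clifford7 :: "clifford7 \<Rightarrow> clifford7 \<Rightarrow> clifford7"
  is "\<lambda>f g C. if C \<subseteq> {1..7}
    then \<Sum>A\<in>Pow {1..7}. reorder_sign A (sym_diff A C) * f A * g (sym_diff A C) else 0"
  by simp

lemma coeff_times:
  "C \<subseteq> {1..7} \<Longrightarrow> coeff (x * y) C =
    (\<Sum>A\<in>Pow {1..7}. reorder_sign A (sym_diff A C) * coeff x A * coeff y (sym_diff A C))"
  by transfer simp

lemma times_assoc_clifford7: "x * y * z = x * (y * z)" for x y z :: clifford7
proof (rule clifford7_eqI)
  fix D :: "nat set" assume D: "D \<subseteq> {1..7}"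
  let ?P = "Pow {1..7::nat}"
  have fin: "finite A" if "A \<subseteq> {1..7::nat}" for A using that finite_subset by blast
  have "coeff (x * y * z) D = (\<Sum>E\<in>?P. \<Sum>A\<in>?P.
      reorder_sign E (sym_diff E D) * (reorder_sign A (sym_diff A E) * coeff x A
        * coeff y (sym_diff A E)) * coeff z (sym_diff E D))"
    unfolding coeff_times[OF D]
    by (intro sum.cong refl) (simp only: coeff_times Pow_iff sum_distrib_left sum_distrib_right)
  also have "\<dots> = (\<Sum>A\<in>?P. \<Sum>E\<in>?P.
      reorder_sign E (sym_diff E D) * (reorder_sign A (sym_diff A E) * coeff x A
        * coeff y (sym_diff A E)) * coeff z (sym_diff E D))"
    by (rule sum.swap)
  also have "\<dots> = (\<Sum>A\<in>?P. \<Sum>B\<in>?P.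
      reorder_sign A (sym_diff A D) * coeff x A * (reorder_sign B (sym_diff B (sym_diff A D))
        * coeff y B * coeff z (sym_diff B (sym_diff A D))))"
  proof (rule sum.cong[OF refl])
    fix A assume A: "A \<in> ?P"
    have swap: "sym_diff A (sym_diff A X) = X" for X by blast
    show "(\<Sum>E\<in>?P. reorder_sign E (sym_diff E D) * (reorder_sign A (sym_diff A E) * coeff x A
            * coeff y (sym_diff A E)) * coeff z (sym_diff E D)) =
          (\<Sum>B\<in>?P. reorder_sign A (sym_diff A D) * coeff x A
            * (reorder_sign B (sym_diff B (sym_diff A D))
            * coeff y B * coeff z (sym_diff B (sym_diff A D))))"
    proof (rule sum.reindex_bij_witness[where i = "\<lambda>X. sym_diff A X" and j = "\<lambda>X. sym_diff A X"])
      fix E assume E: "E \<in> ?P"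
      have f: "finite A" "finite E" "finite D" using A E D fin by auto
      have d: "sym_diff (sym_diff A E) (sym_diff A D) = sym_diff E D" by blast
      have s1: "reorder_sign E (sym_diff E D)
          = reorder_sign A (sym_diff E D) * reorder_sign (sym_diff A E) (sym_diff E D)"
        using reorder_sign_sym_diff_left[of A "sym_diff A E" "sym_diff E D"] f
        by (simp add: swap)
      have d2: "sym_diff (sym_diff A E) (sym_diff E D) = sym_diff A D" by blast
      have s2: "reorder_sign A (sym_diff A D)
          = reorder_sign A (sym_diff A E) * reorder_sign A (sym_diff E D)"
        using reorder_sign_sym_diff_right[of "sym_diff A E" "sym_diff E D" A] f
        unfolding d2 by simp
      show "reorder_sign A (sym_diff A D) * coeff x A
            * (reorder_sign (sym_diff A E) (sym_diff (sym_diff A E) (sym_diff A D))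
            * coeff y (sym_diff A E) * coeff z (sym_diff (sym_diff A E) (sym_diff A D)))
          = reorder_sign E (sym_diff E D) * (reorder_sign A (sym_diff A E) * coeff x A
            * coeff y (sym_diff A E)) * coeff z (sym_diff E D)"
        unfolding d s1 s2 by (simp only: ac_simps)
    qed (use A in \<open>blast+\<close>)
  qed
  also have "\<dots> = (\<Sum>A\<in>?P. reorder_sign A (sym_diff A D) * coeff x A *
      (\<Sum>B\<in>?P. reorder_sign B (sym_diff B (sym_diff A D)) * coeff y B
        * coeff z (sym_diff B (sym_diff A D))))"
    by (simp only: sum_distrib_left)
  also have "\<dots> = coeff (x * (y * z)) D"
  proof -
    have "sym_diff A D \<subseteq> {1..7}" if "A \<in> ?P" for A using that D by blast
    then show ?thesis
      unfolding coeff_times[OF D] by (intro sum.cong refl) (simp only: coeff_times)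
  qed
  finally show "coeff (x * y * z) D = coeff (x * (y * z)) D" .
qed

instance
proof
  fix x y z :: clifford7 and r s :: real
  show "x + y + z = x + (y + z)" by transfer (simp add: algebra_simps)
  show "x + y = y + x" by transfer (simp add: algebra_simps)
  show "0 + x = x" by transfer simp
  show "- x + x = 0" by transfer simp
  show "x - y = x + - y" by transfer simp
  show "r *\<^sub>R (x + y) = r *\<^sub>R x + r *\<^sub>R y" by transfer (simp add: algebra_simps)
  show "(r + s) *\<^sub>R x = r *\<^sub>R x + s *\<^sub>R x" by transfer (simp add: algebra_simps)
  show "r *\<^sub>R s *\<^sub>R x = (r * s) *\<^sub>R x" by transfer (simp add: algebra_simps)
  show "1 *\<^sub>R x = x" by transfer simp
  show "x * y * z = x * (y * z)" by (rule times_assoc_clifford7)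
  show "(x + y) * z = x * z + y * z"
    by (rule clifford7_eqI)
       (simp only: coeff_times plus_clifford7.rep_eq distrib_left distrib_right sum.distrib)
  show "x * (y + z) = x * y + x * z"
    by (rule clifford7_eqI)
       (simp only: coeff_times plus_clifford7.rep_eq distrib_left distrib_right sum.distrib)
  show "r *\<^sub>R x * y = r *\<^sub>R (x * y)"
    by (rule clifford7_eqI)
       (simp only: coeff_times scaleR_clifford7.rep_eq sum_distrib_left ac_simps)
  show "x * r *\<^sub>R y = r *\<^sub>R (x * y)"
    by (rule clifford7_eqI)
       (simp only: coeff_times scaleR_clifford7.rep_eq sum_distrib_left ac_simps)
  show "1 * x = x"
  proof (rule clifford7_eqI)
    fix C :: "nat set" assume C: "C \<subseteq> {1..7}"
    have "coeff (1 * x) C = (\<Sum>A\<in>Pow {1..7::nat}. if A = {} then coeff x C else 0)"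
      unfolding coeff_times[OF C] one_clifford7.rep_eq by (intro sum.cong refl) simp
    then show "coeff (1 * x) C = coeff x C" by simp
  qed
  show "x * 1 = x"
  proof (rule clifford7_eqI)
    fix C :: "nat set" assume C: "C \<subseteq> {1..7}"
    have eq: "sym_diff A C = {} \<longleftrightarrow> A = C" for A by blast
    have "coeff (x * 1) C = (\<Sum>A\<in>Pow {1..7::nat}. if A = C then coeff x C else 0)"
      unfolding coeff_times[OF C] one_clifford7.rep_eq eq by (intro sum.cong refl) simp
    then show "coeff (x * 1) C = coeff x C" using C by simp
  qed
  have "coeff 0 {} \<noteq> coeff 1 {}"
    by (simp add: zero_clifford7.rep_eq one_clifford7.rep_eq)
  then show "(0::clifford7) \<noteq> 1" by metis
qed

end

lift_definition gen :: "nat \<Rightarrow> clifford7"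
  is "\<lambda>a A. if a \<in> {1..7} \<and> A = {a} then 1 else 0" by auto

definition eform :: "nat list \<Rightarrow> clifford7" where
  "eform as = prod_list (map gen as)"

abbreviation eset :: "nat set \<Rightarrow> clifford7" where
  "eset A \<equiv> eform (sorted_list_of_set A)"

text \<open>
  The defining relations hold, and the products \<open>eset A\<close> of generators are the basis to which
  \<open>coeff\<close> refers; so the type is the 128-dimensional algebra Cl(7,0).
\<close>

lemma coeff_sum: "coeff (\<Sum>i\<in>J. f i) A = (\<Sum>i\<in>J. coeff (f i) A)"
  by (induction J rule: infinite_finite_induct)
     (auto simp: zero_clifford7.rep_eq plus_clifford7.rep_eq)

lemma coeff_gen_times:
  assumes "a \<in> {1..7}" "C \<subseteq> {1..7}"
  shows "coeff (gen a * y) C = reorder_sign {a} (sym_diff {a} C) * coeff y (sym_diff {a} C)"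
proof -
  have "coeff (gen a * y) C = (\<Sum>A\<in>Pow {1..7}. if A = {a}
      then reorder_sign {a} (sym_diff {a} C) * coeff y (sym_diff {a} C) else 0)"
    unfolding coeff_times[OF assms(2)] using assms(1)
    by (intro sum.cong refl) (simp add: gen.rep_eq)
  then show ?thesis using assms(1) by simp
qed

lemma sym_diff_eq_iff: "sym_diff A B = C \<longleftrightarrow> B = sym_diff A C"
  by blast

lemma gen_square:
  assumes "a \<in> {1..7}"
  shows "gen a * gen a = 1"
proof (rule clifford7_eqI)
  fix C :: "nat set" assume C: "C \<subseteq> {1..7}"
  have eq: "sym_diff {a} C = {a} \<longleftrightarrow> C = {}" by blast
  have "coeff (gen a * gen a) C
      = reorder_sign {a} (sym_diff {a} C) * (if sym_diff {a} C = {a} then 1 else 0)"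
    using coeff_gen_times[OF assms C, of "gen a"] assms by (simp add: gen.rep_eq)
  also have "\<dots> = coeff 1 C"
    unfolding eq by (simp add: one_clifford7.rep_eq reorder_sign_def)
  finally show "coeff (gen a * gen a) C = coeff 1 C" .
qed

lemma gen_anticommute:
  assumes "a \<in> {1..7}" "b \<in> {1..7}" "a \<noteq> b"
  shows "gen a * gen b = - (gen b * gen a)"
proof (rule clifford7_eqI)
  fix C :: "nat set" assume C: "C \<subseteq> {1..7}"
  have eq: "sym_diff {a} C = {b} \<longleftrightarrow> C = {a, b}" "sym_diff {b} C = {a} \<longleftrightarrow> C = {a, b}"
    using assms(3) sym_diff_eq_iff[of "{a}" C "{b}"] sym_diff_eq_iff[of "{b}" C "{a}"]
    by (simp_all add: insert_commute Un_commute)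
  have "coeff (gen a * gen b) C
      = (if sym_diff {a} C = {b} then reorder_sign {a} {b} else 0)"
    using coeff_gen_times[OF assms(1) C, of "gen b"] assms(2) by (simp add: gen.rep_eq)
  moreover have "coeff (gen b * gen a) C
      = (if sym_diff {b} C = {a} then reorder_sign {b} {a} else 0)"
    using coeff_gen_times[OF assms(2) C, of "gen a"] assms(1) by (simp add: gen.rep_eq)
  moreover have "reorder_sign {a} {b} = - reorder_sign {b} {a}"
    using assms(3) by (auto simp: reorder_sign_def)
  ultimately show "coeff (gen a * gen b) C = coeff (- (gen b * gen a)) C"
    unfolding eq by (simp add: uminus_clifford7.rep_eq)
qed

lemma coeff_eform_sorted:
  assumes "sorted_wrt (<) as" "set as \<subseteq> {1..7}"
  shows "coeff (eform as) A = (if A = set as then 1 else 0)"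
  using assms
proof (induction as arbitrary: A)
  case Nil
  then show ?case by (simp add: eform_def one_clifford7.rep_eq)
next
  case (Cons a as)
  show ?case
  proof (cases "A \<subseteq> {1..7}")
    case True
    have "a \<notin> set as" using Cons.prems(1) by auto
    then have eq: "sym_diff {a} A = set as \<longleftrightarrow> A = set (a # as)"
      using sym_diff_eq_iff[of "{a}" A "set as"] by simp
    have "reorder_sign {a} (set as) = 1"
      using Cons.prems(1) by (auto simp: reorder_sign_def intro!: prod.neutral)
    moreover have "coeff (eform (a # as)) A
        = reorder_sign {a} (sym_diff {a} A) * coeff (eform as) (sym_diff {a} A)"
      using Cons.prems(2) True coeff_gen_times[of a A "eform as"] by (simp add: eform_def)
    moreover have "coeff (eform as) (sym_diff {a} A)
        = (if sym_diff {a} A = set as then 1 else 0)"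
      using Cons by auto
    ultimately show ?thesis using eq by (auto split: if_splits)
  next
    case False
    then show ?thesis using Cons.prems(2) coeff_outside by auto
  qed
qed

lemma coeff_eset:
  assumes "A \<subseteq> {1..7}"
  shows "coeff (eset A) B = (if B = A then 1 else 0)"
proof -
  have "finite A" using assms finite_subset by blast
  then show ?thesis using coeff_eform_sorted[of "sorted_list_of_set A" B] assms by simp
qed

lemma clifford7_expansion: "x = (\<Sum>A\<in>Pow {1..7}. coeff x A *\<^sub>R eset A)"
proof (rule clifford7_eqI)
  fix C :: "nat set" assume C: "C \<subseteq> {1..7}"
  have "coeff (\<Sum>A\<in>Pow {1..7}. coeff x A *\<^sub>R eset A) C
      = (\<Sum>A\<in>Pow {1..7}. if C = A then coeff x C else 0)"
    unfolding coeff_sum by (intro sum.cong) (auto simp: scaleR_clifford7.rep_eq coeff_eset)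
  then show "coeff x C = coeff (\<Sum>A\<in>Pow {1..7}. coeff x A *\<^sub>R eset A) C"
    using C by simp
qed

definition unit_vectors :: "clifford7 set" where
  "unit_vectors = {\<Sum>a\<in>{1..7}. c a *\<^sub>R gen a | c. (\<Sum>a\<in>{1..7}. (c a)\<^sup>2) = 1}"

definition Pin7 :: "clifford7 set" where
  "Pin7 = {prod_list vs | vs. set vs \<subseteq> unit_vectors}"

definition Spin7 :: "clifford7 set" where
  "Spin7 = {prod_list vs | vs. set vs \<subseteq> unit_vectors \<and> even (length vs)}"

definition fano_lines :: "nat set set \<Rightarrow> bool" where
  "fano_lines F \<longleftrightarrow> F \<subseteq> {S. S \<subseteq> {1..7} \<and> card S = 3} \<and> card F = 7 \<and>
    (\<forall>T. T \<subseteq> {1..7} \<and> card T = 2 \<longrightarrow> (\<exists>!S. S \<in> F \<and> T \<subseteq> S))"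

definition primary_3form :: "clifford7 \<Rightarrow> bool" where
  "primary_3form \<Phi> \<longleftrightarrow> (\<exists>F. fano_lines F \<and> \<Phi> = (\<Sum>S\<in>F. eset S))"

definition pseudoscalar :: clifford7 where
  "pseudoscalar = eform [1, 2, 3, 4, 5, 6, 7]"

definition dual :: "clifford7 \<Rightarrow> clifford7" where
  "dual X = - (pseudoscalar * X)"

text \<open>
  Terms carry their coefficient: a basis form \<open>e_S\<close> occurring in \<open>X\<close> with coefficient \<open>-1\<close>
  contributes the term \<open>- e_S\<close>, which is again a basis form (with its indices in another order).
\<close>

definition terms :: "clifford7 \<Rightarrow> clifford7 set" where
  "terms X = {coeff X A *\<^sub>R eset A | A. coeff X A \<noteq> 0}"

definition commutative_subalgebra :: "'a::real_algebra_1 set \<Rightarrow> bool" where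
  "commutative_subalgebra S \<longleftrightarrow> subspace S \<and> 1 \<in> S \<and>
    (\<forall>x\<in>S. \<forall>y\<in>S. x * y \<in> S) \<and> (\<forall>x\<in>S. \<forall>y\<in>S. x * y = y * x)"

end

theory Submission
  imports Defs
begin

text \<open>
  Two basis forms multiply by \<open>e_A e_B = \<plusminus> e_C\<close>, where \<open>C\<close> is the symmetric difference of \<open>A\<close>
  and \<open>B\<close>, and they commute exactly when \<open>|A| |B| + |A \<inter> B|\<close> is even. Hence both claims are
  about the families of index sets that occur: the span of the terms is a commutative subalgebra
  as soon as the family contains the empty set and is closed under symmetric difference, that is, is a
  binary linear code of length 7, and satisfies the parity condition (\<open>terms_of_commuting_code\<close>).

  For \<open>1 + \<Phi>\<^sup>*\<close> the family consists of the empty set and the complements of the seven lines. In a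
  Fano plane two lines meet in a single point \<open>p\<close>, and the two points outside both lines form with
  \<open>p\<close> a third line; its complement is the symmetric difference of the two lines, which is also
  that of their complements. So the family is a linear code (\<open>fano_code_closed\<close>), the simplex code.
  All its weights are 0 or 4. A linear code with weights divisible by 4 is self-orthogonal,
  because \<open>2 |A \<inter> B| = |A| + |B| - |C|\<close>, and this gives the parity condition.

  For \<open>1 + \<Phi> + \<Phi>\<^sup>* + I\<close> the family is the same code together with the complements of its members.
  Closure is inherited, and so is commutation, because 7 is odd and therefore \<open>I\<close> is central.
  Finally, each term is \<open>\<plusminus> e_A\<close>, a product of \<open>|A|\<close> generators up to the sign
  \<open>-1 = (- e\<^sub>1) e\<^sub>1\<close>, so it lies in \<open>Pin(7)\<close>, and in \<open>Spin(7)\<close> if \<open>|A|\<close> is even.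
\<close>

section \<open>Products of basis forms\<close>

abbreviation points :: "nat set" where
  "points \<equiv> {1..7}"

lemma finite_index_set: "A \<subseteq> points \<Longrightarrow> finite A"
  using finite_subset by blast

lemma coeff_eset_times:
  assumes "A \<subseteq> points" "C \<subseteq> points"
  shows "coeff (eset A * y) C = reorder_sign A (sym_diff A C) * coeff y (sym_diff A C)"
proof -
  have "coeff (eset A * y) C = (\<Sum>B\<in>Pow points. if B = A
      then reorder_sign A (sym_diff A C) * coeff y (sym_diff A C) else 0)"
    unfolding coeff_times[OF assms(2)] using assms(1)
    by (intro sum.cong refl) (simp add: coeff_eset)
  then show ?thesis using assms(1) by simp
qed

lemma eset_times:
  assumes "A \<subseteq> points" "B \<subseteq> points"
  shows "eset A * eset B = reorder_sign A B *\<^sub>R eset (sym_diff A B)"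
proof (rule clifford7_eqI)
  fix C :: "nat set" assume C: "C \<subseteq> points"
  have D: "sym_diff A B \<subseteq> points" using assms by blast
  have "sym_diff A C = B \<longleftrightarrow> C = sym_diff A B" by blast
  then show "coeff (eset A * eset B) C
      = coeff (reorder_sign A B *\<^sub>R eset (sym_diff A B)) C"
    using assms coeff_eset_times[OF assms(1) C, of "eset B"] coeff_eset[OF D, of C]
    by (auto simp: coeff_eset scaleR_clifford7.rep_eq)
qed

text \<open>
  Moving \<open>e_A\<close> past \<open>e_B\<close> costs one sign for every pair of distinct indices from \<open>A\<close> and \<open>B\<close>,
  and there are \<open>|A| |B| - |A \<inter> B|\<close> such pairs.
\<close>

lemma reorder_sign_swap:
  assumes "finite A" "finite B"
  shows "reorder_sign A B * reorder_sign B A = (-1) ^ (card A * card B + card (A \<inter> B))"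
proof -
  have BA: "reorder_sign B A = (\<Prod>a\<in>A. \<Prod>b\<in>B. if a < b then -1 else 1)"
    unfolding reorder_sign_def by (rule prod.swap)
  have "reorder_sign A B * reorder_sign B A
      = (\<Prod>a\<in>A. \<Prod>b\<in>B. - 1 * (if b = a then - 1 else 1))"
    unfolding BA unfolding reorder_sign_def prod.distrib[symmetric]
    by (intro prod.cong refl) auto
  also have "\<dots> = (\<Prod>a\<in>A. (-1) ^ card B * (if a \<in> B then - 1 else 1))"
    by (intro prod.cong refl)
       (simp only: prod.distrib prod_constant prod.delta[OF assms(2)])
  also have "\<dots> = (-1) ^ (card A * card B) * (\<Prod>a\<in>A. if a \<in> B then - 1 else 1)"
    by (simp add: prod.distrib power_mult[symmetric] mult.commute)
  also have "(\<Prod>a\<in>A. if a \<in> B then - 1 else (1::real)) = (-1) ^ card (A \<inter> B)"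
    using assms(1) by (simp add: prod.inter_restrict[symmetric])
  finally show ?thesis by (simp add: power_add)
qed

lemma eset_commute:
  assumes "A \<subseteq> points" "B \<subseteq> points" "even (card A * card B + card (A \<inter> B))"
  shows "eset A * eset B = eset B * eset A"
proof -
  have "reorder_sign A B * reorder_sign B A = 1"
    using assms(3) reorder_sign_swap[OF assms(1,2)[THEN finite_index_set]] by simp
  then have "reorder_sign A B = reorder_sign B A"
    using reorder_sign_square[of B A] by (metis mult.assoc mult_1 mult_1_right)
  moreover have "sym_diff A B = sym_diff B A" by blast
  ultimately show ?thesis using assms(1,2) by (simp only: eset_times)
qed

lemma reorder_sign_cases: "reorder_sign A B = 1 \<or> reorder_sign A B = - 1"
  using reorder_sign_square[of A B] square_eq_1_iff by blast

section \<open>Signed basis forms in the Pin and Spin groups\<close>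

lemma signed_gen_unit_vector:
  assumes "a \<in> points" "s\<^sup>2 = 1"
  shows "s *\<^sub>R gen a \<in> unit_vectors"
proof -
  let ?c = "\<lambda>b. if b = a then s else 0"
  have "(\<Sum>b\<in>points. ?c b *\<^sub>R gen b) = (\<Sum>b\<in>points. if b = a then s *\<^sub>R gen b else 0)"
    by (intro sum.cong) auto
  moreover have "(\<Sum>b\<in>points. (?c b)\<^sup>2) = (\<Sum>b\<in>points. if b = a then s\<^sup>2 else 0)"
    by (intro sum.cong) auto
  ultimately have "s *\<^sub>R gen a = (\<Sum>b\<in>points. ?c b *\<^sub>R gen b)" "(\<Sum>b\<in>points. (?c b)\<^sup>2) = 1"
    using assms by simp_all
  then show ?thesis
    unfolding unit_vectors_def by (intro CollectI exI[of _ ?c] conjI)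
qed

lemma signed_eset_product_of_unit_vectors:
  assumes "A \<subseteq> points" "s = 1 \<or> s = - 1"
  shows "\<exists>vs. s *\<^sub>R eset A = prod_list vs \<and> set vs \<subseteq> unit_vectors
    \<and> even (length vs) = even (card A)"
proof -
  let ?as = "sorted_list_of_set A"
  \<comment> \<open>The factor \<open>(s e\<^sub>1) e\<^sub>1 = s\<close> carries the sign without changing the parity of the length.\<close>
  let ?vs = "s *\<^sub>R gen 1 # gen 1 # map gen ?as"
  have "(1::real) *\<^sub>R gen a \<in> unit_vectors" if "a \<in> points" for a
    using that by (rule signed_gen_unit_vector) simp
  moreover have "s *\<^sub>R gen 1 \<in> unit_vectors"
    using assms(2) by (intro signed_gen_unit_vector) auto
  ultimately have "set ?vs \<subseteq> unit_vectors"
    using assms(1) finite_index_set[OF assms(1)] by auto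
  moreover have "prod_list ?vs = s *\<^sub>R eset A"
    using gen_square[of 1] by (simp add: eform_def mult.assoc[symmetric])
  moreover have "even (length ?vs) = even (card A)" by simp
  ultimately show ?thesis by metis
qed

section \<open>Terms indexed by a code\<close>

lemma commutative_subalgebra_span:
  fixes T :: "'a::real_algebra_1 set"
  assumes one: "1 \<in> T"
    and closed: "\<And>x y. x \<in> T \<Longrightarrow> y \<in> T \<Longrightarrow> x * y \<in> span T"
    and comm: "\<And>x y. x \<in> T \<Longrightarrow> y \<in> T \<Longrightarrow> x * y = y * x"
  shows "commutative_subalgebra (span T)"
proof -
  have left: "x * y \<in> span T \<and> x * y = y * x" if "x \<in> span T" "y \<in> T" for x y
    using that(1)
  proof (induction rule: span_induct_alt)
    case base
    show ?case by (simp add: span_zero)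
  next
    case (step c u v)
    have "(c *\<^sub>R u + v) * y = c *\<^sub>R (u * y) + v * y" "y * (c *\<^sub>R u + v) = c *\<^sub>R (y * u) + y * v"
      by (simp_all add: distrib_left distrib_right)
    then show ?case
      using step closed[OF _ that(2)] comm[OF _ that(2)] by (metis span_add span_scale)
  qed
  have "x * y \<in> span T \<and> x * y = y * x" if "x \<in> span T" "y \<in> span T" for x y
    using that(2)
  proof (induction rule: span_induct_alt)
    case base
    show ?case by (simp add: span_zero)
  next
    case (step c u v)
    have "x * (c *\<^sub>R u + v) = c *\<^sub>R (x * u) + x * v" "(c *\<^sub>R u + v) * x = c *\<^sub>R (u * x) + v * x"
      by (simp_all add: distrib_left distrib_right)
    then show ?case using step left[OF that(1)] by (metis span_add span_scale)
  qed
  then show ?thesis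
    unfolding commutative_subalgebra_def using one by (simp add: span_base)
qed

text \<open>
  The terms are nonzero multiples of the \<open>e_A\<close> with \<open>A\<close> in the code \<open>K\<close>, so they span the same
  space. A product of two of these forms is up to sign the form of the symmetric difference, which
  again belongs to \<open>K\<close>.
\<close>

lemma terms_of_commuting_code:
  assumes support: "\<And>A. coeff x A \<noteq> 0 \<longleftrightarrow> A \<in> K"
    and one: "coeff x {} = 1"
    and closed: "\<And>A B. A \<in> K \<Longrightarrow> B \<in> K \<Longrightarrow> sym_diff A B \<in> K"
    and parity: "\<And>A B. A \<in> K \<Longrightarrow> B \<in> K \<Longrightarrow> even (card A * card B + card (A \<inter> B))"
  shows "\<forall>u\<in>terms x. \<forall>v\<in>terms x. u * v = v * u"
    and "commutative_subalgebra (span (terms x))"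
proof -
  have sub: "A \<subseteq> points" if "A \<in> K" for A
    using that support coeff_outside by blast
  have comm: "u * v = v * u" if "u \<in> terms x" "v \<in> terms x" for u v
    using that eset_commute[OF sub sub parity] by (auto simp: terms_def support mult.commute)
  then show "\<forall>u\<in>terms x. \<forall>v\<in>terms x. u * v = v * u" by blast
  have mem: "eset A \<in> span (terms x)" if "A \<in> K" for A
  proof -
    have "coeff x A *\<^sub>R eset A \<in> span (terms x)"
      using that by (auto simp: terms_def support intro: span_base)
    then have "inverse (coeff x A) *\<^sub>R coeff x A *\<^sub>R eset A \<in> span (terms x)"
      by (rule span_scale)
    then show ?thesis using that support[of A] by simp
  qed
  have "u * v \<in> span (terms x)" if uv: "u \<in> terms x" "v \<in> terms x" for u v
  proof -
    obtain A B where AB: "A \<in> K" "B \<in> K"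
      "u = coeff x A *\<^sub>R eset A" "v = coeff x B *\<^sub>R eset B"
      using uv by (auto simp: terms_def support)
    then show ?thesis
      using mem[OF closed[OF AB(1,2)]] by (simp add: eset_times[OF sub sub] span_scale)
  qed
  moreover have "1 \<in> terms x"
    unfolding terms_def using one by (auto simp: eform_def intro!: exI[of _ "{}"])
  ultimately show "commutative_subalgebra (span (terms x))"
    using comm by (intro commutative_subalgebra_span)
qed

lemma terms_subset_Pin7:
  assumes "\<And>A. coeff x A \<in> {-1, 0, 1}"
  shows "terms x \<subseteq> Pin7"
proof
  fix u assume "u \<in> terms x"
  then obtain A where A: "coeff x A \<noteq> 0" "u = coeff x A *\<^sub>R eset A" by (auto simp: terms_def)
  then have "A \<subseteq> points" "coeff x A = 1 \<or> coeff x A = - 1"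
    using assms[of A] coeff_outside by auto
  then show "u \<in> Pin7"
    using signed_eset_product_of_unit_vectors A(2) unfolding Pin7_def by blast
qed

lemma terms_subset_Spin7:
  assumes "\<And>A. coeff x A \<in> {-1, 0, 1}" "\<And>A. coeff x A \<noteq> 0 \<Longrightarrow> even (card A)"
  shows "terms x \<subseteq> Spin7"
proof
  fix u assume "u \<in> terms x"
  then obtain A where A: "coeff x A \<noteq> 0" "u = coeff x A *\<^sub>R eset A" by (auto simp: terms_def)
  then have "A \<subseteq> points" "coeff x A = 1 \<or> coeff x A = - 1"
    using assms(1)[of A] coeff_outside by auto
  then show "u \<in> Spin7"
    using signed_eset_product_of_unit_vectors A assms(2) unfolding Spin7_def by blast
qed

section \<open>The code of a Fano plane\<close>

lemma card_points_Diff: "A \<subseteq> points \<Longrightarrow> card (points - A) + card A = 7"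
  using card_mono[of points A] by (simp add: card_Diff_subset finite_index_set)

lemma fano_line_ex1:
  assumes "fano_lines F" "T \<subseteq> points" "card T = 2"
  shows "\<exists>!S. S \<in> F \<and> T \<subseteq> S"
  using assms(1)[unfolded fano_lines_def, THEN conjunct2, THEN conjunct2] assms(2,3)
  by (elim allE[of _ T] impE) (intro conjI)

lemma fano_line_unique:
  assumes "fano_lines F" "S \<in> F" "S' \<in> F" "p \<in> S" "q \<in> S" "p \<in> S'" "q \<in> S'" "p \<noteq> q"
  shows "S = S'"
proof -
  have "S \<subseteq> points" using assms(1,2) by (auto simp: fano_lines_def)
  then have "{p, q} \<subseteq> points" "card {p, q} = 2" using assms(4,5,8) by auto
  then have "\<exists>!S. S \<in> F \<and> {p, q} \<subseteq> S"
    by (rule fano_line_ex1[OF assms(1)])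
  then show ?thesis using assms(2-7) by (metis empty_subsetI insert_subset)
qed

lemma fano_line_through:
  assumes "fano_lines F" "p \<in> points" "q \<in> points" "p \<noteq> q"
  obtains r where "{p, q, r} \<in> F" "r \<in> points" "r \<noteq> p" "r \<noteq> q"
proof -
  have "{p, q} \<subseteq> points" "card {p, q} = 2" using assms by auto
  then have "\<exists>!S. S \<in> F \<and> {p, q} \<subseteq> S"
    by (rule fano_line_ex1[OF assms(1)])
  then obtain S where S: "S \<in> F" "p \<in> S" "q \<in> S" by blast
  then have "card S = 3" "S \<subseteq> points" using assms(1) by (auto simp: fano_lines_def)
  then have "card (S - {p, q}) = 1"
    using S assms(4) by (simp add: card_Diff_subset)
  then obtain r where "S - {p, q} = {r}" by (meson card_1_singletonE)
  then have "S = {p, q, r}" "r \<noteq> p" "r \<noteq> q" using S by auto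
  then show ?thesis using that S(1) \<open>S \<subseteq> points\<close> by auto
qed

text \<open>
  Two disjoint lines would leave a single point \<open>r\<close>. A line joining a point \<open>s\<close> of the first to a
  point of the second has no further point on either, so it contains \<open>r\<close>; but then the joins of
  \<open>s\<close> to two points of the second line share \<open>s\<close> and \<open>r\<close>.
\<close>

lemma fano_lines_meet:
  assumes F: "fano_lines F" and S: "S \<in> F" "S' \<in> F"
  shows "S \<inter> S' \<noteq> {}"
proof
  assume disj: "S \<inter> S' = {}"
  have c: "card S = 3" "card S' = 3" "S \<subseteq> points" "S' \<subseteq> points"
    using F S by (auto simp: fano_lines_def)
  have "card (S \<union> S') = 6"
    using c disj by (simp add: card_Un_disjoint finite_index_set)
  then have "card (points - (S \<union> S')) = 1"
    using card_points_Diff[of "S \<union> S'"] c by simp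
  then obtain r where r: "points - (S \<union> S') = {r}" by (meson card_1_singletonE)
  obtain s where s: "s \<in> S" using c by fastforce
  have join: "{s, t, r} \<in> F" if "t \<in> S'" for t
  proof -
    have st: "s \<noteq> t" "s \<in> points" "t \<in> points" using s that disj c by auto
    then obtain q where q: "{s, t, q} \<in> F" "q \<in> points" "q \<noteq> s" "q \<noteq> t"
      using fano_line_through[OF F] by metis
    have "q \<notin> S"
      using fano_line_unique[OF F S(1) q(1), of s q] s q(3) that disj by auto
    moreover have "q \<notin> S'"
      using fano_line_unique[OF F S(2) q(1), of t q] that q(4) s disj by auto
    ultimately have "q = r" using q(2) r by blast
    then show ?thesis using q(1) by simp
  qed
  obtain t t' where t: "t \<in> S'" "t' \<in> S'" "t \<noteq> t'"
    using c(2) by (auto simp: card_3_iff)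
  have "s \<noteq> r" using r s by auto
  then have "{s, t, r} = {s, t', r}"
    using fano_line_unique[OF F join[OF t(1)] join[OF t(2)], of s r] by simp
  moreover have "t \<noteq> s" "t \<noteq> r" using t(1) s disj r by auto
  ultimately show False using t(3) by auto
qed

text \<open>
  Through the common point \<open>p\<close> of two lines there is exactly one more line. It joins \<open>p\<close> to any
  point off the two lines, and it must contain the other such point too, since it can meet
  neither line again.
\<close>

lemma fano_third_line:
  assumes F: "fano_lines F" and S: "S \<in> F" "S' \<in> F" "S \<noteq> S'"
  shows "points - sym_diff S S' \<in> F"
proof -
  have c: "card S = 3" "card S' = 3" "S \<subseteq> points" "S' \<subseteq> points"
    using F S by (auto simp: fano_lines_def)
  obtain p where p: "p \<in> S" "p \<in> S'" using fano_lines_meet[OF F S(1,2)] by blast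
  have pS: "S \<inter> S' = {p}" using fano_line_unique[OF F S(1,2)] p S(3) by blast
  have "card (S \<union> S') = 5"
    using card_Un_Int[of S S'] c pS by (simp add: finite_index_set)
  then have "card (points - (S \<union> S')) = 2"
    using card_points_Diff[of "S \<union> S'"] c by simp
  then obtain r r' where r: "points - (S \<union> S') = {r, r'}" "r \<noteq> r'"
    by (meson card_2_iff)
  have "r \<in> points - (S \<union> S')" unfolding r(1) by simp
  then have rp: "r \<notin> S" "r \<notin> S'" "r \<in> points" "p \<noteq> r" "p \<in> points"
    using p c by blast+
  obtain q where q: "{p, r, q} \<in> F" "q \<in> points" "q \<noteq> p" "q \<noteq> r"
    using fano_line_through[OF F rp(5,3,4)] .
  have "q \<notin> S" using fano_line_unique[OF F S(1) q(1), of p q] p q(3) rp(1) by auto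
  moreover have "q \<notin> S'" using fano_line_unique[OF F S(2) q(1), of p q] p q(3) rp(2) by auto
  ultimately have "q = r'" using q r by blast
  moreover have "points - sym_diff S S' = {p, r, r'}" using r(1) pS rp(5) by blast
  ultimately show ?thesis using q(1) by simp
qed

definition fano_code :: "nat set set \<Rightarrow> nat set set" where
  "fano_code F = insert {} ((\<lambda>S. points - S) ` F)"

lemma fano_code_closed:
  assumes F: "fano_lines F" and AB: "A \<in> fano_code F" "B \<in> fano_code F"
  shows "sym_diff A B \<in> fano_code F"
proof (cases "A = {} \<or> B = {} \<or> A = B")
  case True
  then show ?thesis using AB by (auto simp: fano_code_def)
next
  case False
  then obtain S S' where S: "S \<in> F" "S' \<in> F" "A = points - S" "B = points - S'"
    using AB by (auto simp: fano_code_def)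
  then have "S \<subseteq> points" "S' \<subseteq> points" using F by (auto simp: fano_lines_def)
  then have "sym_diff A B = points - (points - sym_diff S S')" unfolding S by blast
  then show ?thesis using fano_third_line[OF F S(1,2)] False S unfolding fano_code_def by blast
qed

lemma fano_code_subset_points: "A \<in> fano_code F \<Longrightarrow> A \<subseteq> points"
  by (auto simp: fano_code_def)

lemma fano_code_weight:
  assumes "fano_lines F" "A \<in> fano_code F"
  shows "card A = 0 \<or> card A = 4"
proof (cases "A = {}")
  case False
  then obtain S where S: "S \<in> F" "A = points - S" using assms(2) by (auto simp: fano_code_def)
  then have "S \<subseteq> points" "card S = 3" using assms(1) by (auto simp: fano_lines_def)
  then show ?thesis using card_points_Diff[of S] S by simp
qed simp

text \<open>
  Self-orthogonality: \<open>2 |A \<inter> B| = |A| + |B| - |C|\<close> for the symmetric difference \<open>C\<close>, and all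
  weights on the right are divisible by 4.
\<close>

lemma fano_code_even_Int:
  assumes F: "fano_lines F" and AB: "A \<in> fano_code F" "B \<in> fano_code F"
  shows "even (card (A \<inter> B))"
proof -
  have fin: "finite A" "finite B"
    using AB fano_code_subset_points finite_index_set by blast+
  have "card A = card (A \<inter> B) + card (A - B)" "card B = card (A \<inter> B) + card (B - A)"
    using card_Int_Diff[OF fin(1), of B] card_Int_Diff[OF fin(2), of A]
    by (simp_all add: Int_commute)
  moreover have "card (sym_diff A B) = card (A - B) + card (B - A)"
    using fin by (intro card_Un_disjoint) auto
  ultimately have "card A + card B = 2 * card (A \<inter> B) + card (sym_diff A B)" by simp
  moreover have "4 dvd card C" if "C \<in> fano_code F" for C
    using fano_code_weight[OF F that] by auto
  then have "4 dvd card A" "4 dvd card B" "4 dvd card (sym_diff A B)"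
    using AB fano_code_closed[OF F AB] by blast+
  ultimately show ?thesis by presburger
qed

text \<open>
  Passing from \<open>A\<close> to its complement multiplies \<open>e_A\<close> by \<open>\<plusminus> I\<close>, and \<open>I\<close> is central because 7
  is odd. So the form of the complement commutes with the same basis forms as \<open>e_A\<close>.
\<close>

lemma commuting_parity_complement:
  assumes "A \<subseteq> points" "B \<subseteq> points"
  shows "even (card (points - A) * card B + card ((points - A) \<inter> B))
    = even (card A * card B + card (A \<inter> B))"
proof -
  have "(points - A) \<inter> B = B - A" using assms(2) by blast
  then have "card B = card (A \<inter> B) + card ((points - A) \<inter> B)"
    using card_Int_Diff[of B A] assms(2) by (simp add: Int_commute finite_index_set)
  moreover have "even (card (points - A)) \<noteq> even (card A)"
    using card_points_Diff[OF assms(1)] by presburger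
  ultimately show ?thesis by (metis even_add even_mult_iff)
qed

definition extended_code :: "nat set set \<Rightarrow> nat set set" where
  "extended_code K = K \<union> (\<lambda>A. points - A) ` K"

lemma extended_code_closed:
  assumes sub: "\<And>A. A \<in> K \<Longrightarrow> A \<subseteq> points"
    and closed: "\<And>A B. A \<in> K \<Longrightarrow> B \<in> K \<Longrightarrow> sym_diff A B \<in> K"
    and AB: "A \<in> extended_code K" "B \<in> extended_code K"
  shows "sym_diff A B \<in> extended_code K"
proof -
  have eqs: "sym_diff (points - C) D = points - sym_diff C D"
    "sym_diff C (points - D) = points - sym_diff C D"
    "sym_diff (points - C) (points - D) = sym_diff C D" if "C \<in> K" "D \<in> K" for C D
    using sub[OF that(1)] sub[OF that(2)] by blast+
  obtain C D where CD: "C \<in> K" "D \<in> K"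
    "A = C \<or> A = points - C" "B = D \<or> B = points - D"
    using AB unfolding extended_code_def by blast
  then have "sym_diff A B = sym_diff C D \<or> sym_diff A B = points - sym_diff C D"
    using eqs[OF CD(1,2)] by (elim disjE) (simp_all only: simp_thms)
  then show ?thesis using closed[OF CD(1,2)] unfolding extended_code_def
    by (metis UnI1 UnI2 imageI)
qed

lemma extended_code_parity:
  assumes sub: "\<And>A. A \<in> K \<Longrightarrow> A \<subseteq> points"
    and parity: "\<And>A B. A \<in> K \<Longrightarrow> B \<in> K \<Longrightarrow> even (card A * card B + card (A \<inter> B))"
    and AB: "A \<in> extended_code K" "B \<in> extended_code K"
  shows "even (card A * card B + card (A \<inter> B))"
proof -
  obtain C D where CD: "C \<in> K" "D \<in> K"
    "A = C \<or> A = points - C" "B = D \<or> B = points - D"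
    using AB unfolding extended_code_def by blast
  have s: "C \<subseteq> points" "D \<subseteq> points" "B \<subseteq> points" using CD sub by blast+
  have "even (card C * card B + card (C \<inter> B)) = even (card B * card C + card (B \<inter> C))"
    by (simp only: mult.commute Int_commute)
  also have "\<dots> = even (card D * card C + card (D \<inter> C))"
    using CD(4) commuting_parity_complement[OF s(2,1)] by blast
  finally have "even (card C * card B + card (C \<inter> B))" using parity[OF CD(2,1)] by simp
  then show ?thesis using CD(3) commuting_parity_complement[OF s(1,3)] by blast
qed

section \<open>Coefficients of a primary form and of its dual\<close>

lemma pseudoscalar_eq_eset: "pseudoscalar = eset points"
proof (rule clifford7_eqI)
  fix A :: "nat set"
  have "set [1, 2, 3, 4, 5, 6, 7::nat] = points" by auto
  then show "coeff pseudoscalar A = coeff (eset points) A"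
    using coeff_eform_sorted[of "[1, 2, 3, 4, 5, 6, 7]" A]
    by (simp add: pseudoscalar_def coeff_eset)
qed

lemma coeff_dual:
  assumes "A \<subseteq> points"
  shows "coeff (dual x) A = - (reorder_sign points (points - A) * coeff x (points - A))"
proof -
  have "sym_diff points A = points - A" using assms by blast
  then show ?thesis using coeff_eset_times[of points A x] assms
    by (simp add: dual_def pseudoscalar_eq_eset uminus_clifford7.rep_eq)
qed

lemma coeff_sum_eset:
  assumes "F \<subseteq> Pow points"
  shows "coeff (\<Sum>S\<in>F. eset S) A = (if A \<in> F then 1 else 0)"
proof -
  have "finite F" using assms by (rule finite_subset) simp
  moreover have "coeff (\<Sum>S\<in>F. eset S) A = (\<Sum>S\<in>F. if A = S then 1 else 0)"
    unfolding coeff_sum using assms by (intro sum.cong refl coeff_eset) blast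
  ultimately show ?thesis by simp
qed

lemma dual_terms_code:
  assumes F: "fano_lines F" and x: "x = 1 + dual (\<Sum>S\<in>F. eset S)"
  shows "coeff x A \<in> {-1, 0, 1}" "coeff x A \<noteq> 0 \<longleftrightarrow> A \<in> fano_code F" "coeff x {} = 1"
proof -
  have FP: "F \<subseteq> Pow points" and points: "points \<notin> F"
    using F by (auto simp: fano_lines_def)
  have dual: "coeff (dual (\<Sum>S\<in>F. eset S)) A
      = (if points - A \<in> F then - reorder_sign points (points - A) else 0)"
    if "A \<subseteq> points" for A
    using coeff_dual[OF that] coeff_sum_eset[OF FP] by simp
  then show one: "coeff x {} = 1"
    using points by (simp add: x plus_clifford7.rep_eq one_clifford7.rep_eq)
  have coeff_x: "coeff x A
      = (if points - A \<in> F then - reorder_sign points (points - A) else 0)"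
    if "A \<subseteq> points" "A \<noteq> {}"
    using that dual by (simp add: x plus_clifford7.rep_eq one_clifford7.rep_eq)
  show "coeff x A \<in> {-1, 0, 1}"
    using one coeff_x coeff_outside[of A x] reorder_sign_cases[of points "points - A"]
    by (cases "A \<subseteq> points"; cases "A = {}") auto
  have compl: "A \<in> (\<lambda>S. points - S) ` F \<longleftrightarrow> points - A \<in> F" if "A \<subseteq> points"
  proof
    assume "A \<in> (\<lambda>S. points - S) ` F"
    then show "points - A \<in> F" using FP by (auto simp: double_diff)
  next
    assume "points - A \<in> F"
    moreover have "A = points - (points - A)" using that by blast
    ultimately show "A \<in> (\<lambda>S. points - S) ` F" by blast
  qed
  show "coeff x A \<noteq> 0 \<longleftrightarrow> A \<in> fano_code F"
  proof (cases "A \<subseteq> points \<and> A \<noteq> {}")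
    case True
    then show ?thesis
      using coeff_x compl reorder_sign_cases[of points "points - A"]
      by (auto simp: fano_code_def)
  next
    case False
    then show ?thesis
      using one coeff_outside[of A x] fano_code_subset_points[of A F]
      by (auto simp: fano_code_def)
  qed
qed

text \<open>
  The terms of \<open>\<Phi> + I\<close> have odd degree and those of \<open>1 + \<Phi>\<^sup>*\<close> even degree, so no
  coefficients add up.
\<close>

lemma all_terms_code:
  assumes F: "fano_lines F"
    and x: "x = 1 + (\<Sum>S\<in>F. eset S) + dual (\<Sum>S\<in>F. eset S) + pseudoscalar"
  shows "coeff x A \<in> {-1, 0, 1}"
    "coeff x A \<noteq> 0 \<longleftrightarrow> A \<in> extended_code (fano_code F)" "coeff x {} = 1"
proof -
  let ?y = "1 + dual (\<Sum>S\<in>F. eset S)"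
  let ?odd = "insert points F"
  note y = dual_terms_code[OF F refl]
  have FP: "F \<subseteq> Pow points" and points: "points \<notin> F"
    and card_F: "\<And>S. S \<in> F \<Longrightarrow> card S = 3"
    using F by (auto simp: fano_lines_def)
  have "x = ?y + ((\<Sum>S\<in>F. eset S) + pseudoscalar)" unfolding x by (simp add: ac_simps)
  then have coeff_x: "coeff x A = coeff ?y A + (if A \<in> ?odd then 1 else 0)" for A
    using coeff_sum_eset[OF FP] points
    by (auto simp: plus_clifford7.rep_eq pseudoscalar_eq_eset coeff_eset)
  have "A \<notin> fano_code F" if "A \<in> ?odd" for A
    using fano_code_weight[OF F, of A] that card_F[of A] by auto
  then have disj: "coeff ?y A = 0" if "A \<in> ?odd" for A using that y(2) by blast
  show "coeff x A \<in> {-1, 0, 1}" using y(1)[of A] disj[of A] coeff_x[of A] by auto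
  have "(\<lambda>A. points - A) ` fano_code F = ?odd"
    using FP by (force simp: fano_code_def image_image double_diff)
  then show "coeff x A \<noteq> 0 \<longleftrightarrow> A \<in> extended_code (fano_code F)"
    using y(2)[of A] disj[of A] coeff_x[of A] unfolding extended_code_def by auto
  have "{} \<notin> ?odd" using card_F[of "{}"] by auto
  then show "coeff x {} = 1" using coeff_x y(3) by simp
qed

theorem lemma1:
  fixes \<Phi> :: clifford7
  assumes "primary_3form \<Phi>"
  shows "(let T = terms (1 + dual \<Phi>) in
            T \<subseteq> Spin7 \<and> (\<forall>x\<in>T. \<forall>y\<in>T. x * y = y * x) \<and> commutative_subalgebra (span T))
       \<and> (let T = terms (1 + \<Phi> + dual \<Phi> + pseudoscalar) in
            T \<subseteq> Pin7 \<and> (\<forall>x\<in>T. \<forall>y\<in>T. x * y = y * x) \<and> commutative_subalgebra (span T))"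
proof -
  obtain F where F: "fano_lines F" and \<Phi>: "\<Phi> = (\<Sum>S\<in>F. eset S)"
    using assms by (auto simp: primary_3form_def)
  have even_weight: "even (card A)" if "A \<in> fano_code F" for A
    using fano_code_weight[OF F that] by auto
  then have parity: "even (card A * card B + card (A \<inter> B))"
    if "A \<in> fano_code F" "B \<in> fano_code F" for A B
    using fano_code_even_Int[OF F that] that by simp
  note a = dual_terms_code[OF F refl, folded \<Phi>]
  note b = all_terms_code[OF F refl, folded \<Phi>]
  let ?x = "1 + dual \<Phi>" and ?y = "1 + \<Phi> + dual \<Phi> + pseudoscalar"
  have ext: "sym_diff A B \<in> extended_code (fano_code F)"
    "even (card A * card B + card (A \<inter> B))"
    if AB: "A \<in> extended_code (fano_code F)" "B \<in> extended_code (fano_code F)" for A B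
    using extended_code_closed[OF _ _ AB] extended_code_parity[OF _ _ AB]
      fano_code_subset_points fano_code_closed[OF F] parity by blast+
  have "terms ?x \<subseteq> Spin7"
    using a(1,2) even_weight by (intro terms_subset_Spin7) blast+
  moreover have "(\<forall>u\<in>terms ?x. \<forall>v\<in>terms ?x. u * v = v * u)
      \<and> commutative_subalgebra (span (terms ?x))"
    using terms_of_commuting_code[of ?x, OF a(2,3)] fano_code_closed[OF F] parity by blast
  moreover have "terms ?y \<subseteq> Pin7"
    using b(1) by (rule terms_subset_Pin7)
  moreover have "(\<forall>u\<in>terms ?y. \<forall>v\<in>terms ?y. u * v = v * u)
      \<and> commutative_subalgebra (span (terms ?y))"
    using terms_of_commuting_code[of ?y, OF b(2,3)] ext by blast
  ultimately show ?thesis unfolding Let_def by blast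
qed

end
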